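(* Let $(B,\rho,u,\phi)$ be a sufficiently smooth solution on $\Omega\times[0,\infty)$, $\Omega=[a,b]$, with periodic boundary conditions in $x$, of the system $$\begin{cases} B_t = \mathrm{i}\big(\omega B_{xx}-\kappa\big(u-\tfrac12\nu\rho+q\phi\big)B\big),\\ \rho_t=\partial_x\big(-u+\nu\rho-\kappa\phi\big),\\ u_t=\partial_x\big(-\beta\rho+\nu u+\tfrac12\kappa\nu\phi\big),\\ \phi_t=2\,\mathrm{Re}(\bar B\, B_t),\end{cases}\qquad x\in\Omega,\ t\ge 0,$$ with initial conditions $B(x,0)=B_0(x)$, $\rho(x,0)=\rho_0(x)$, $u(x,0)=u_0(x)$, $\phi(x,0)=|B_0(x)|^2$ for $x\in\Omega$. Then: (i) with $H_1(x,t)=\phi(x,t)-|B(x,t)|^2$, one has $H_1(x,t)=H_1(x,0)=0$ for all $x\in\Omega$ and $t\ge0$; (ii) the modified quadratic energy $$\mathcal{E}(t)=\int_\Omega\Big(-\omega|B_x|^2-\kappa\big(u-\tfrac{\nu}{2}\rho+\tfrac q2\phi\big)\phi-\tfrac{\beta}{2}\rho^2-\tfrac12u^2+\nu u\rho\Big)\,dx$$ is conserved, i.e. $\mathcal{E}(t)=\mathcal{E}(0)$ for all $t\ge0$.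
   Context: $B$ is complex-valued; $\rho,u,\phi$ are real-valued. $\omega,\kappa,\nu,\beta,q$ are given real constants with $q=\kappa+\frac{\nu(\kappa\nu-1)}{4(\beta-\nu^2)}$ (so $\beta\neq\nu^2$). $\Omega=[a,b]$ is a bounded interval, and periodic boundary conditions mean that all functions are $(b-a)$-periodic in $x$. $\mathrm{Re}$ denotes the real part and the bar complex conjugation. *)

theory Defs
  imports "HOL-Analysis.Analysis" "HOL-Library.Periodic_Fun"
begin

text \<open>
  A field is a function \<open>f x t\<close> of position \<open>x\<close> and time \<open>t\<close>. Periodic fields on \<open>[a, b]\<close> are
  represented by their \<open>(b - a)\<close>-periodic extension to the whole real line in \<open>x\<close>. Only times
  \<open>t \<ge> 0\<close> matter: the time derivative is taken within \<open>{0..}\<close>, hence is one-sided at \<open>t = 0\<close>.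
\<close>

definition dx :: "(real \<Rightarrow> real \<Rightarrow> 'a::real_normed_vector) \<Rightarrow> real \<Rightarrow> real \<Rightarrow> 'a" where
  "dx f x t = vector_derivative (\<lambda>y. f y t) (at x)"

definition dt :: "(real \<Rightarrow> real \<Rightarrow> 'a::real_normed_vector) \<Rightarrow> real \<Rightarrow> real \<Rightarrow> 'a" where
  "dt f x t = vector_derivative (\<lambda>s. f x s) (at t within {0..})"

definition C0 :: "(real \<Rightarrow> real \<Rightarrow> 'a::real_normed_vector) \<Rightarrow> bool" where
  "C0 f \<longleftrightarrow> continuous_on (UNIV \<times> {0..}) (\<lambda>(x, t). f x t)"

definition C1_space :: "(real \<Rightarrow> real \<Rightarrow> 'a::real_normed_vector) \<Rightarrow> bool" where
  "C1_space f \<longleftrightarrow> C0 f \<and> (\<forall>x. \<forall>t\<ge>0. (\<lambda>y. f y t) differentiable (at x)) \<and> C0 (dx f)"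

definition C1_time :: "(real \<Rightarrow> real \<Rightarrow> 'a::real_normed_vector) \<Rightarrow> bool" where
  "C1_time f \<longleftrightarrow>
     C0 f \<and> (\<forall>x. \<forall>t\<ge>0. (\<lambda>s. f x s) differentiable (at t within {0..})) \<and> C0 (dt f)"

definition periodic_field :: "real \<Rightarrow> real \<Rightarrow> (real \<Rightarrow> real \<Rightarrow> 'a) \<Rightarrow> bool" where
  "periodic_field a b f \<longleftrightarrow> (\<forall>t\<ge>0. periodic_fun_simple (\<lambda>x. f x t) (b - a))"

text \<open>
  ``Sufficiently smooth'' is read as classical regularity, the weakest usual reading: the unknowns
  and their partial derivatives of the kinds occurring in the system (\<open>B\<^sub>t\<close>, \<open>B\<^sub>x\<close>, \<open>B\<^sub>x\<^sub>x\<close> and the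
  first derivatives of \<open>\<rho>\<close>, \<open>u\<close>, \<open>\<phi>\<close>) exist and are jointly continuous up to \<open>t = 0\<close>.
\<close>

definition sufficiently_smooth ::
  "(real \<Rightarrow> real \<Rightarrow> complex) \<Rightarrow> (real \<Rightarrow> real \<Rightarrow> real) \<Rightarrow> (real \<Rightarrow> real \<Rightarrow> real) \<Rightarrow>
   (real \<Rightarrow> real \<Rightarrow> real) \<Rightarrow> bool" where
  "sufficiently_smooth B \<rho> u \<phi> \<longleftrightarrow>
     C1_time B \<and> C1_space B \<and> C1_space (dx B) \<and>
     C1_time \<rho> \<and> C1_space \<rho> \<and> C1_time u \<and> C1_space u \<and> C1_time \<phi> \<and> C1_space \<phi>"

definition solves_system ::
  "real \<Rightarrow> real \<Rightarrow> real \<Rightarrow> real \<Rightarrow> real \<Rightarrow> real \<Rightarrow> real \<Rightarrow>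
   (real \<Rightarrow> real \<Rightarrow> complex) \<Rightarrow> (real \<Rightarrow> real \<Rightarrow> real) \<Rightarrow> (real \<Rightarrow> real \<Rightarrow> real) \<Rightarrow>
   (real \<Rightarrow> real \<Rightarrow> real) \<Rightarrow> bool" where
  "solves_system \<omega> \<kappa> \<nu> \<beta> q a b B \<rho> u \<phi> \<longleftrightarrow>
     (\<forall>x\<in>{a..b}. \<forall>t\<ge>0.
        dt B x t = \<i> * (complex_of_real \<omega> * dx (dx B) x t
          - complex_of_real (\<kappa> * (u x t - 1/2 * \<nu> * \<rho> x t + q * \<phi> x t)) * B x t) \<and>
        dt \<rho> x t = dx (\<lambda>y s. - u y s + \<nu> * \<rho> y s - \<kappa> * \<phi> y s) x t \<and>
        dt u x t = dx (\<lambda>y s. - \<beta> * \<rho> y s + \<nu> * u y s + 1/2 * \<kappa> * \<nu> * \<phi> y s) x t \<and>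
        dt \<phi> x t = 2 * Re (cnj (B x t) * dt B x t))"

definition H1 :: "(real \<Rightarrow> real \<Rightarrow> complex) \<Rightarrow> (real \<Rightarrow> real \<Rightarrow> real) \<Rightarrow> real \<Rightarrow> real \<Rightarrow> real" where
  "H1 B \<phi> x t = \<phi> x t - (cmod (B x t))\<^sup>2"

definition energy ::
  "real \<Rightarrow> real \<Rightarrow> real \<Rightarrow> real \<Rightarrow> real \<Rightarrow> real \<Rightarrow> real \<Rightarrow>
   (real \<Rightarrow> real \<Rightarrow> complex) \<Rightarrow> (real \<Rightarrow> real \<Rightarrow> real) \<Rightarrow> (real \<Rightarrow> real \<Rightarrow> real) \<Rightarrow>
   (real \<Rightarrow> real \<Rightarrow> real) \<Rightarrow> real \<Rightarrow> real" where
  "energy \<omega> \<kappa> \<nu> \<beta> q a b B \<rho> u \<phi> t =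
     integral {a..b} (\<lambda>x.
       - \<omega> * (cmod (dx B x t))\<^sup>2
       - \<kappa> * (u x t - \<nu>/2 * \<rho> x t + q/2 * \<phi> x t) * \<phi> x t
       - \<beta>/2 * (\<rho> x t)\<^sup>2 - 1/2 * (u x t)\<^sup>2 + \<nu> * u x t * \<rho> x t)"

end

theory Submission imports Defs begin

text \<open>
  Part (i) is immediate, since \<open>\<phi>\<close> and \<open>|B|\<^sup>2\<close> have the same time derivative.

  For part (ii), put \<open>P = \<nu>\<kappa>/2 \<phi> - \<beta>\<rho> + \<nu>u\<close> and \<open>Q = -\<kappa>\<phi> - u + \<nu>\<rho>\<close>. The system says
  \<open>\<rho>\<^sub>t = Q\<^sub>x\<close> and \<open>u\<^sub>t = P\<^sub>x\<close>, while \<open>\<phi>\<^sub>t = 2 Re (cnj B B\<^sub>t)\<close> makes the \<open>\<phi>\<^sub>t\<close> terms cancel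
  against \<open>2\<omega> Re (cnj B\<^sub>x\<^sub>x B\<^sub>t)\<close> because \<open>i B\<^sub>t\<close> is orthogonal to \<open>B\<^sub>t\<close>. Hence the energy changes
  at the rate \<open>\<integral> (P Q\<^sub>x + Q P\<^sub>x) = \<integral> (P Q)\<^sub>x = 0\<close>.

  The mixed derivative \<open>B\<^sub>x\<^sub>t\<close> need not exist, so \<open>\<integral> |B\<^sub>x|\<^sup>2\<close> cannot be differentiated under the
  integral sign. Instead, integration by parts turns
  \<open>|B\<^sub>x(s)|\<^sup>2 - |B\<^sub>x(t)|\<^sup>2 = (B\<^sub>x(s) + B\<^sub>x(t)) \<bullet> (B\<^sub>x(s) - B\<^sub>x(t))\<close> into
  \<open>- (B\<^sub>x\<^sub>x(s) + B\<^sub>x\<^sub>x(t)) \<bullet> (B(s) - B(t))\<close>, whose quotient by \<open>s - t\<close> is continuous.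
\<close>

section \<open>Continuity, derivatives and periodicity of fields\<close>

text \<open>The compositional form serves slices in \<open>x\<close>, pairs in the order
  \<open>(s, x)\<close> and segments of times alike.\<close>

lemma C0_continuous_on:
  assumes "C0 f" "continuous_on S X" "continuous_on S T" "\<And>p. p \<in> S \<Longrightarrow> 0 \<le> T p"
  shows "continuous_on S (\<lambda>p. f (X p) (T p))"
proof -
  have "continuous_on S (\<lambda>p. (X p, T p))"
    using assms by (intro continuous_intros)
  from continuous_on_compose2[OF assms(1)[unfolded C0_def] this] assms(4)
  show ?thesis by auto
qed

lemma C1_time_has_vector_derivative:
  assumes "C1_time f" "0 \<le> t"
  shows "((\<lambda>s. f x s) has_vector_derivative dt f x t) (at t within {0..})"
  using assms unfolding C1_time_def dt_def by (simp flip: vector_derivative_works)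

lemma C1_space_has_vector_derivative:
  assumes "C1_space f" "0 \<le> t"
  shows "((\<lambda>y. f y t) has_vector_derivative dx f x t) (at x)"
  using assms unfolding C1_space_def dx_def by (simp flip: vector_derivative_works)

lemma periodic_field_endpoints:
  assumes "periodic_field a b f" "0 \<le> t"
  shows "f b t = f a t"
  using assms periodic_fun_simple.plus_period[of "\<lambda>x. f x t" "b - a" a]
  unfolding periodic_field_def by auto

text \<open>The chain rule for the shift by \<open>b - a\<close>, with uniqueness of derivatives. It
  makes the boundary terms containing \<open>dx B\<close> agree at \<open>a\<close> and
  \<open>b\<close>.\<close>

lemma periodic_field_dx:
  assumes "periodic_field a b f" "C1_space f"
  shows "periodic_field a b (dx f)"
  unfolding periodic_field_def
proof (intro allI impI)
  fix t :: real assume t: "0 \<le> t"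
  have per: "f (y + (b - a)) t = f y t" for y
    using assms(1) t periodic_fun_simple.plus_period[of "\<lambda>x. f x t" "b - a" y]
    unfolding periodic_field_def by auto
  show "periodic_fun_simple (\<lambda>x. dx f x t) (b - a)"
  proof
    fix x
    have shift: "((\<lambda>y. y + (b - a)) has_vector_derivative 1) (at x)"
      by (auto intro!: derivative_eq_intros)
    have "((\<lambda>y. f (y + (b - a)) t) has_vector_derivative dx f (x + (b - a)) t) (at x)"
      using vector_diff_chain_at[OF shift
          C1_space_has_vector_derivative[OF assms(2) t, of "x + (b - a)"]]
      by (simp add: o_def)
    then show "dx f (x + (b - a)) t = dx f x t"
      unfolding per using C1_space_has_vector_derivative[OF assms(2) t, of x]
      by (rule vector_derivative_unique_at)
  qed
qed

section \<open>Averages of the time derivative\<close>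

text \<open>The difference quotient of \<open>f x\<close> between \<open>t\<close> and
  \<open>s\<close>, in a form that stays meaningful at \<open>s = t\<close>. Scaling the segment to
  \<open>{0..1}\<close> fixes the domain of integration and also covers
  \<open>s < t\<close>.\<close>

definition mean_dt :: "(real \<Rightarrow> real \<Rightarrow> 'a::euclidean_space) \<Rightarrow> real \<Rightarrow> real \<Rightarrow> real \<Rightarrow> 'a" where
  "mean_dt f x t s = integral {0..1} (\<lambda>\<theta>. dt f x (t + \<theta> * (s - t)))"

lemma convex_comb_nonneg:
  fixes s t \<theta> :: real
  assumes "0 \<le> s" "0 \<le> t" "\<theta> \<in> {0..1}"
  shows "0 \<le> t + \<theta> * (s - t)"
proof -
  have "t + \<theta> * (s - t) = (1 - \<theta>) * t + \<theta> * s" by (simp add: algebra_simps)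
  also have "\<dots> \<ge> 0" using assms by (intro add_nonneg_nonneg mult_nonneg_nonneg) auto
  finally show ?thesis .
qed

lemma mean_dt_increment:
  assumes "C1_time f" "0 \<le> s" "0 \<le> t"
  shows "f x s - f x t = (s - t) *\<^sub>R mean_dt f x t s"
proof -
  have "((\<lambda>\<theta>. (s - t) *\<^sub>R dt f x (t + \<theta> * (s - t))) has_integral
      f x (t + 1 * (s - t)) - f x (t + 0 * (s - t))) {0..1}"
  proof (rule fundamental_theorem_of_calculus)
    fix \<theta> :: real assume \<theta>: "\<theta> \<in> {0..1}"
    have line: "((\<lambda>\<theta>. t + \<theta> * (s - t)) has_vector_derivative s - t) (at \<theta> within {0..1})"
      by (auto intro!: derivative_eq_intros)
    \<comment> \<open>The derivative within \<open>{0..}\<close> restricts to the segment from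
      \<open>t\<close> to \<open>s\<close>, which stays in \<open>{0..}\<close> by
      convexity.\<close>
    have "((\<lambda>r. f x r) has_vector_derivative dt f x (t + \<theta> * (s - t)))
        (at (t + \<theta> * (s - t)) within (\<lambda>\<theta>. t + \<theta> * (s - t)) ` {0..1})"
      using convex_comb_nonneg[OF assms(2,3)] \<theta>
      by (intro has_vector_derivative_within_subset
          [OF C1_time_has_vector_derivative[OF assms(1)]]) auto
    from vector_diff_chain_within[OF line this]
    show "((\<lambda>\<theta>. f x (t + \<theta> * (s - t))) has_vector_derivative
        (s - t) *\<^sub>R dt f x (t + \<theta> * (s - t))) (at \<theta> within {0..1})"
      by (simp add: o_def)
  qed simp
  from integral_unique[OF this] show ?thesis
    by (simp add: mean_dt_def)
qed

lemma mean_dt_same [simp]: "mean_dt f x t t = dt f x t"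
  by (simp add: mean_dt_def)

lemma continuous_on_mean_dt:
  assumes "C1_time f" "0 \<le> t"
  shows "continuous_on (UNIV \<times> {0..}) (\<lambda>(x, s). mean_dt f x t s)"
proof -
  have "continuous_on ((UNIV \<times> {0..}) \<times> cbox 0 1)
      (\<lambda>(p, \<theta>). dt f (fst p) (t + \<theta> * (snd p - t)))"
    unfolding split_beta using assms convex_comb_nonneg[OF _ assms(2)]
    by (intro C0_continuous_on[of "dt f"] continuous_intros) (auto simp: C1_time_def)
  from integral_continuous_on_param[OF this] show ?thesis
    by (simp add: mean_dt_def split_beta)
qed

lemma continuous_on_mean_dt_comp:
  assumes "C1_time f" "0 \<le> t" "continuous_on S X" "continuous_on S T" "\<And>p. p \<in> S \<Longrightarrow> 0 \<le> T p"
  shows "continuous_on S (\<lambda>p. mean_dt f (X p) t (T p))"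
  using assms continuous_on_mean_dt[OF assms(1,2)]
  by (intro C0_continuous_on[of "\<lambda>x s. mean_dt f x t s"]) (auto simp: C0_def)

section \<open>The time derivative of the Dirichlet integral\<close>

lemma dirichlet_integral_increment:
  fixes f :: "real \<Rightarrow> real \<Rightarrow> 'a::euclidean_space"
  assumes "a \<le> b" and f: "C1_time f" "C1_space f" "C1_space (dx f)"
    and per: "periodic_field a b f" and s: "0 \<le> s" and t: "0 \<le> t"
  shows "integral {a..b} (\<lambda>x. (norm (dx f x s))\<^sup>2) - integral {a..b} (\<lambda>x. (norm (dx f x t))\<^sup>2) =
    (s - t) * - integral {a..b} (\<lambda>x. (dx (dx f) x s + dx (dx f) x t) \<bullet> mean_dt f x t s)"
proof -
  have C0: "C0 f" "C0 (dx f)" "C0 (dx (dx f))"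
    using f by (auto simp: C1_space_def)
  note D = C1_space_has_vector_derivative
  have ends: "f b s = f a s" "f b t = f a t" "dx f b s = dx f a s" "dx f b t = dx f a t"
    using periodic_field_endpoints[OF per] periodic_field_endpoints[OF periodic_field_dx[OF per f(2)]]
      s t by auto
  let ?I = "integral {a..b} (\<lambda>x. (dx f x s + dx f x t) \<bullet> (dx f x s - dx f x t))"
  \<comment> \<open>The shape \<open>- - ?I\<close> fits the last premise of
    \<open>integration_by_parts\<close> with result \<open>- ?I\<close>. By periodicity the two
    boundary terms cancel, so only integrability is left to show.\<close>
  have "((\<lambda>x. (dx f x s + dx f x t) \<bullet> (dx f x s - dx f x t)) has_integral
      (dx f b s + dx f b t) \<bullet> (f b s - f b t) - (dx f a s + dx f a t) \<bullet> (f a s - f a t) - - ?I) {a..b}"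
    unfolding ends using s t
    by (simp, intro integrable_integral integrable_continuous_interval continuous_intros
        C0[THEN C0_continuous_on]) auto
  then have parts: "((\<lambda>x. (dx (dx f) x s + dx (dx f) x t) \<bullet> (f x s - f x t)) has_integral - ?I) {a..b}"
    by (rule integration_by_parts[OF bounded_bilinear_inner \<open>a \<le> b\<close>, rotated -1])
      (use s t f in \<open>auto intro!: has_vector_derivative_add has_vector_derivative_diff D
        continuous_intros C0[THEN C0_continuous_on]\<close>)
  have "integral {a..b} (\<lambda>x. (norm (dx f x s))\<^sup>2) - integral {a..b} (\<lambda>x. (norm (dx f x t))\<^sup>2) =
      integral {a..b} (\<lambda>x. (norm (dx f x s))\<^sup>2 - (norm (dx f x t))\<^sup>2)"
    using s t by (intro integral_diff[symmetric] integrable_continuous_interval continuous_intros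
        C0[THEN C0_continuous_on]) auto
  also have "\<dots> = ?I"
    by (simp add: power2_norm_eq_inner algebra_simps inner_commute)
  also have "\<dots> = - integral {a..b}
      (\<lambda>x. (dx (dx f) x s + dx (dx f) x t) \<bullet> ((s - t) *\<^sub>R mean_dt f x t s))"
    using integral_unique[OF parts] mean_dt_increment[OF f(1) s t] by simp
  finally show ?thesis by simp
qed

lemma dirichlet_integral_has_derivative:
  fixes f :: "real \<Rightarrow> real \<Rightarrow> 'a::euclidean_space"
  assumes "a \<le> b" and f: "C1_time f" "C1_space f" "C1_space (dx f)"
    and per: "periodic_field a b f" and t: "0 \<le> t"
  shows "((\<lambda>s. integral {a..b} (\<lambda>x. (norm (dx f x s))\<^sup>2)) has_real_derivative
    - (2 * integral {a..b} (\<lambda>x. dx (dx f) x t \<bullet> dt f x t))) (at t within {0..})"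
proof -
  \<comment> \<open>For \<open>s \<noteq> t\<close> this is the difference quotient of the Dirichlet
    integral. Its formula contains no division, so it is continuous through
    \<open>s = t\<close>.\<close>
  define M where "M s = - integral {a..b}
    (\<lambda>x. (dx (dx f) x s + dx (dx f) x t) \<bullet> mean_dt f x t s)" for s
  have "continuous_on ({0..} \<times> cbox a b)
      (\<lambda>(s, x). (dx (dx f) x s + dx (dx f) x t) \<bullet> mean_dt f x t s)"
    unfolding split_beta using f t
    by (intro continuous_intros C0_continuous_on[of "dx (dx f)"] continuous_on_mean_dt_comp[of f])
      (auto simp: C1_space_def)
  from integral_continuous_on_param[OF this]
  have "continuous_on {0..} M"
    unfolding M_def by (auto intro: continuous_on_minus)
  then have "(M \<longlongrightarrow> M t) (at t within {0..})"
    using t by (auto simp: continuous_on_def)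
  moreover have "\<forall>\<^sub>F s in at t within {0..}. M s =
      (integral {a..b} (\<lambda>x. (norm (dx f x s))\<^sup>2) - integral {a..b} (\<lambda>x. (norm (dx f x t))\<^sup>2)) / (s - t)"
    unfolding eventually_at_filter M_def
    using dirichlet_integral_increment[OF assms(1-5) _ t] by (intro always_eventually) auto
  ultimately have "((\<lambda>s. (integral {a..b} (\<lambda>x. (norm (dx f x s))\<^sup>2) -
      integral {a..b} (\<lambda>x. (norm (dx f x t))\<^sup>2)) / (s - t)) \<longlongrightarrow> M t) (at t within {0..})"
    by (rule Lim_transform_eventually)
  \<comment> \<open>At \<open>s = t\<close> the two summands coincide, whence the factor 2, and the
    mean becomes \<open>dt f x t\<close>.\<close>
  moreover have "M t = - (2 * integral {a..b} (\<lambda>x. dx (dx f) x t \<bullet> dt f x t))"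
    unfolding M_def by (simp add: inner_add_left flip: mult_2)
  ultimately show ?thesis
    unfolding has_field_derivative_iff by simp
qed

section \<open>Cancellation identities and constancy in time\<close>

text \<open>The integrand is the derivative of \<open>f * g\<close>, whose endpoint values
  agree.\<close>

lemma integral_periodic_dx_prod:
  fixes f g :: "real \<Rightarrow> real"
  assumes "a \<le> b" "f b = f a" "g b = g a"
    and "\<And>x. (f has_real_derivative f' x) (at x)" "\<And>x. (g has_real_derivative g' x) (at x)"
  shows "((\<lambda>x. f x * g' x + g x * f' x) has_integral 0) {a..b}"
proof -
  have "((\<lambda>x. f x * g' x + g x * f' x) has_integral f b * g b - f a * g a) {a..b}"
  proof (rule fundamental_theorem_of_calculus[OF \<open>a \<le> b\<close>])
    fix x
    have "((\<lambda>x. f x * g x) has_real_derivative f x * g' x + g x * f' x) (at x within {a..b})"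
      using DERIV_mult[OF assms(4,5)[THEN has_field_derivative_at_within]] by (simp add: ac_simps)
    then show "((\<lambda>x. f x * g x) has_vector_derivative f x * g' x + g x * f' x) (at x within {a..b})"
      by (simp only: has_real_derivative_iff_has_vector_derivative)
  qed
  then show ?thesis using assms by simp
qed

text \<open>Dividing the equation by \<open>\<i>\<close> shows that \<open>w * z'' - m * z\<close>
  is \<open>- \<i> * z'\<close>, a quarter turn of \<open>z'\<close> and so orthogonal to it in the
  real inner product of the plane.\<close>

lemma inner_schroedinger_rhs:
  fixes w m :: real and z z' z'' :: complex
  assumes "z' = \<i> * (complex_of_real w * z'' - complex_of_real m * z)"
  shows "w * (z'' \<bullet> z') = m * (z \<bullet> z')"
  unfolding assms by (simp add: inner_complex_def algebra_simps)

lemma constant_on_nonneg: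
  fixes f :: "real \<Rightarrow> real"
  assumes "\<And>t. 0 \<le> t \<Longrightarrow> (f has_real_derivative 0) (at t within {0..})" "0 \<le> t"
  shows "f t = f 0"
  using has_field_derivative_zero_constant[of "{0..}" f] assms by force

section \<open>Conservation of \<open>H1\<close>\<close>

lemma H1_conserved:
  assumes "C1_time B" "C1_time \<phi>"
    and eq: "\<And>t. 0 \<le> t \<Longrightarrow> dt \<phi> x t = 2 * Re (cnj (B x t) * dt B x t)" and "0 \<le> t"
  shows "H1 B \<phi> x t = H1 B \<phi> x 0"
proof (rule constant_on_nonneg[OF _ \<open>0 \<le> t\<close>])
  fix t :: real assume t: "0 \<le> t"
  have "((\<lambda>s. B x s \<bullet> B x s) has_derivative (\<lambda>h. B x t \<bullet> (h *\<^sub>R dt B x t) + (h *\<^sub>R dt B x t) \<bullet> B x t))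
      (at t within {0..})"
    using C1_time_has_vector_derivative[OF assms(1) t]
    unfolding has_vector_derivative_def by (intro has_derivative_inner)
  then have "((\<lambda>s. B x s \<bullet> B x s) has_real_derivative 2 * (B x t \<bullet> dt B x t)) (at t within {0..})"
    unfolding has_field_derivative_def by (rule has_derivative_eq_rhs) (auto simp: inner_commute)
  moreover have "((\<lambda>s. \<phi> x s) has_real_derivative dt \<phi> x t) (at t within {0..})"
    using C1_time_has_vector_derivative[OF assms(2) t]
    by (simp add: has_real_derivative_iff_has_vector_derivative)
  moreover have "dt \<phi> x t = 2 * (B x t \<bullet> dt B x t)"
    by (simp add: eq[OF t] inner_complex_def)
  ultimately have "((\<lambda>s. \<phi> x s - B x s \<bullet> B x s) has_real_derivative 0) (at t within {0..})"
    by (auto intro!: derivative_eq_intros)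
  then show "(H1 B \<phi> x has_real_derivative 0) (at t within {0..})"
    unfolding H1_def[abs_def] by (simp add: power2_norm_eq_inner)
qed

section \<open>Conservation of the energy\<close>

text \<open>This part of the energy contains no space derivatives, so it can be differentiated under
  the integral sign. The coefficients of \<open>dt \<rho>\<close>, \<open>dt u\<close> and
  \<open>dt \<phi>\<close> are the partial derivatives of the density in \<open>\<rho>\<close>,
  \<open>u\<close> and \<open>\<phi>\<close>; the term quadratic in \<open>\<phi>\<close> turns
  \<open>q/2\<close> into \<open>q\<close>.\<close>

lemma potential_energy_has_derivative:
  fixes \<rho> u \<phi> :: "real \<Rightarrow> real \<Rightarrow> real"
  assumes C1: "C1_time \<rho>" "C1_time u" "C1_time \<phi>" and t: "0 \<le> t"
  shows "((\<lambda>t. integral {a..b} (\<lambda>x. - \<kappa> * (u x t - \<nu>/2 * \<rho> x t + q/2 * \<phi> x t) * \<phi> x t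
       - \<beta>/2 * (\<rho> x t)\<^sup>2 - 1/2 * (u x t)\<^sup>2 + \<nu> * u x t * \<rho> x t)) has_real_derivative
     integral {a..b} (\<lambda>x. (\<nu> * \<kappa> / 2 * \<phi> x t - \<beta> * \<rho> x t + \<nu> * u x t) * dt \<rho> x t
       + (- \<kappa> * \<phi> x t - u x t + \<nu> * \<rho> x t) * dt u x t
       - \<kappa> * (u x t - \<nu>/2 * \<rho> x t + q * \<phi> x t) * dt \<phi> x t)) (at t within {0..})"
proof -
  have C0: "C0 \<rho>" "C0 u" "C0 \<phi>" "C0 (dt \<rho>)" "C0 (dt u)" "C0 (dt \<phi>)"
    using C1 by (auto simp: C1_time_def)
  have D: "((\<lambda>s. f x s) has_real_derivative dt f x s) (at s within {0..})"
    if "C1_time f" "0 \<le> s" for f :: "real \<Rightarrow> real \<Rightarrow> real" and x s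
    using C1_time_has_vector_derivative[OF that]
    by (simp add: has_real_derivative_iff_has_vector_derivative)
  show ?thesis
    unfolding box_real(2)[symmetric]
  proof (rule leibniz_rule_field_derivative)
    fix s x :: real assume "s \<in> {0..}"
    then have "0 \<le> s" by simp
    note D[OF C1(1) this, derivative_intros] D[OF C1(2) this, derivative_intros]
      D[OF C1(3) this, derivative_intros]
    show "((\<lambda>t. - \<kappa> * (u x t - \<nu>/2 * \<rho> x t + q/2 * \<phi> x t) * \<phi> x t
       - \<beta>/2 * (\<rho> x t)\<^sup>2 - 1/2 * (u x t)\<^sup>2 + \<nu> * u x t * \<rho> x t) has_real_derivative
       (\<nu> * \<kappa> / 2 * \<phi> x s - \<beta> * \<rho> x s + \<nu> * u x s) * dt \<rho> x s
       + (- \<kappa> * \<phi> x s - u x s + \<nu> * \<rho> x s) * dt u x s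
       - \<kappa> * (u x s - \<nu>/2 * \<rho> x s + q * \<phi> x s) * dt \<phi> x s) (at s within {0..})"
      by ((rule derivative_eq_intros refl)+) (simp add: algebra_simps)
  next
    fix s :: real assume "s \<in> {0..}"
    then show "(\<lambda>x. - \<kappa> * (u x s - \<nu>/2 * \<rho> x s + q/2 * \<phi> x s) * \<phi> x s
       - \<beta>/2 * (\<rho> x s)\<^sup>2 - 1/2 * (u x s)\<^sup>2 + \<nu> * u x s * \<rho> x s) integrable_on cbox a b"
      by (intro integrable_continuous continuous_intros C0[THEN C0_continuous_on]) auto
  next
    show "continuous_on ({0..} \<times> cbox a b)
       (\<lambda>(t, x). (\<nu> * \<kappa> / 2 * \<phi> x t - \<beta> * \<rho> x t + \<nu> * u x t) * dt \<rho> x t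
       + (- \<kappa> * \<phi> x t - u x t + \<nu> * \<rho> x t) * dt u x t
       - \<kappa> * (u x t - \<nu>/2 * \<rho> x t + q * \<phi> x t) * dt \<phi> x t)"
      unfolding split_beta
      by (intro continuous_intros C0[THEN C0_continuous_on]) auto
  qed (use t in auto)
qed

lemma energy_has_derivative:
  assumes "a \<le> b" and smooth: "sufficiently_smooth B \<rho> u \<phi>"
    and per: "periodic_field a b B" "periodic_field a b \<rho>" "periodic_field a b u"
      "periodic_field a b \<phi>"
    and sol: "solves_system \<omega> \<kappa> \<nu> \<beta> q a b B \<rho> u \<phi>" and t: "0 \<le> t"
  shows "(energy \<omega> \<kappa> \<nu> \<beta> q a b B \<rho> u \<phi> has_real_derivative 0) (at t within {0..})"
proof -
  have C1: "C1_time B" "C1_space B" "C1_space (dx B)" "C1_time \<rho>" "C1_space \<rho>"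
    "C1_time u" "C1_space u" "C1_time \<phi>" "C1_space \<phi>"
    using smooth by (auto simp: sufficiently_smooth_def)
  then have C0: "C0 B" "C0 (dx B)" "C0 (dx (dx B))" "C0 (dt B)" "C0 \<rho>" "C0 u" "C0 \<phi>"
      "C0 (dt \<rho>)" "C0 (dt u)" "C0 (dt \<phi>)"
    by (auto simp: C1_time_def C1_space_def)
  \<comment> \<open>\<open>P\<close> and \<open>Q\<close> are the fluxes of the equations for
    \<open>u\<close> and \<open>\<rho>\<close>, and also the partial derivatives of the density
    \<open>V\<close> in \<open>\<rho>\<close> and \<open>u\<close>. This crosswise pairing produces
    an exact derivative.\<close>
  define P where "P = (\<lambda>x s. - \<beta> * \<rho> x s + \<nu> * u x s + 1/2 * \<kappa> * \<nu> * \<phi> x s)"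
  define Q where "Q = (\<lambda>x s. - u x s + \<nu> * \<rho> x s - \<kappa> * \<phi> x s)"
  define V where "V = (\<lambda>s x. - \<kappa> * (u x s - \<nu>/2 * \<rho> x s + q/2 * \<phi> x s) * \<phi> x s
       - \<beta>/2 * (\<rho> x s)\<^sup>2 - 1/2 * (u x s)\<^sup>2 + \<nu> * u x s * \<rho> x s)"
  define W where "W = (\<lambda>x. (\<nu> * \<kappa> / 2 * \<phi> x t - \<beta> * \<rho> x t + \<nu> * u x t) * dt \<rho> x t
       + (- \<kappa> * \<phi> x t - u x t + \<nu> * \<rho> x t) * dt u x t
       - \<kappa> * (u x t - \<nu>/2 * \<rho> x t + q * \<phi> x t) * dt \<phi> x t)"
  let ?G = "\<lambda>s. - \<omega> * integral {a..b} (\<lambda>x. (cmod (dx B x s))\<^sup>2) + integral {a..b} (V s)"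
  \<comment> \<open>Splitting the integral needs integrable parts, and continuity is known only at
    nonnegative times.\<close>
  have energy: "energy \<omega> \<kappa> \<nu> \<beta> q a b B \<rho> u \<phi> s = ?G s" if "0 \<le> s" for s
  proof -
    have "energy \<omega> \<kappa> \<nu> \<beta> q a b B \<rho> u \<phi> s =
        integral {a..b} (\<lambda>x. - \<omega> * (cmod (dx B x s))\<^sup>2 + V s x)"
      unfolding energy_def V_def by (simp add: algebra_simps)
    also have "\<dots> = integral {a..b} (\<lambda>x. - \<omega> * (cmod (dx B x s))\<^sup>2) + integral {a..b} (V s)"
      unfolding V_def using that
      by (intro integral_add integrable_continuous_interval continuous_intros C0[THEN C0_continuous_on]) auto
    finally show ?thesis by simp
  qed
  have deriv: "(?G has_real_derivative
      - \<omega> * - (2 * integral {a..b} (\<lambda>x. dx (dx B) x t \<bullet> dt B x t)) + integral {a..b} W)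
      (at t within {0..})"
    unfolding V_def W_def
    by (intro DERIV_add DERIV_cmult potential_energy_has_derivative
        dirichlet_integral_has_derivative C1 per t assms)
  have "- \<omega> * - (2 * integral {a..b} (\<lambda>x. dx (dx B) x t \<bullet> dt B x t)) + integral {a..b} W =
      integral {a..b} (\<lambda>x. 2 * \<omega> * (dx (dx B) x t \<bullet> dt B x t)) + integral {a..b} W"
    by simp
  also have "\<dots> = integral {a..b} (\<lambda>x. 2 * \<omega> * (dx (dx B) x t \<bullet> dt B x t) + W x)"
    unfolding W_def using t
    by (intro integral_add[symmetric] integrable_continuous_interval continuous_intros
        C0[THEN C0_continuous_on]) auto
  also have "\<dots> = integral {a..b} (\<lambda>x. P x t * dx Q x t + Q x t * dx P x t)"
  proof (rule integral_cong)
    fix x assume x: "x \<in> {a..b}"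
    \<comment> \<open>The real potential of the Schroedinger equation; \<open>- m\<close> is also
      the coefficient of \<open>dt \<phi> x t\<close> in \<open>W\<close>.\<close>
    define m where "m = \<kappa> * (u x t - 1/2 * \<nu> * \<rho> x t + q * \<phi> x t)"
    have "dt B x t = \<i> * (complex_of_real \<omega> * dx (dx B) x t - complex_of_real m * B x t)"
      and \<rho>: "dt \<rho> x t = dx Q x t" and u: "dt u x t = dx P x t"
      and "dt \<phi> x t = 2 * Re (cnj (B x t) * dt B x t)"
      using sol x t unfolding solves_system_def P_def Q_def m_def by auto
    then have "\<omega> * (dx (dx B) x t \<bullet> dt B x t) = m * (B x t \<bullet> dt B x t)"
      and "dt \<phi> x t = 2 * (B x t \<bullet> dt B x t)"
      using inner_schroedinger_rhs by (blast, simp add: inner_complex_def)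
    \<comment> \<open>The dispersive term thus cancels the last term of \<open>W\<close>, leaving
      only the flux terms.\<close>
    then have "2 * \<omega> * (dx (dx B) x t \<bullet> dt B x t) = m * dt \<phi> x t"
      by simp
    then show "2 * \<omega> * (dx (dx B) x t \<bullet> dt B x t) + W x = P x t * dx Q x t + Q x t * dx P x t"
      unfolding W_def \<rho> u by (simp add: P_def Q_def m_def algebra_simps)
  qed
  also have "\<dots> = 0"
  proof (rule integral_unique, rule integral_periodic_dx_prod[OF \<open>a \<le> b\<close>])
    show "P b t = P a t" "Q b t = Q a t"
      unfolding P_def Q_def using per[THEN periodic_field_endpoints, OF t] by auto
  next
    fix x
    have "(\<lambda>y. P y t) differentiable at x" "(\<lambda>y. Q y t) differentiable at x"
      unfolding P_def Q_def using C1 t by (auto simp: C1_space_def)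
    then show "((\<lambda>y. P y t) has_real_derivative dx P x t) (at x)"
      "((\<lambda>y. Q y t) has_real_derivative dx Q x t) (at x)"
      unfolding dx_def has_real_derivative_iff_has_vector_derivative
      by (simp_all flip: vector_derivative_works)
  qed
  finally have "(?G has_real_derivative 0) (at t within {0..})"
    using deriv by simp
  then show ?thesis
    \<comment> \<open>\<open>?G\<close> and the energy agree on all of \<open>{0..}\<close>, so the
      radius 1 is arbitrary.\<close>
    by (rule has_field_derivative_transform_within[where d = 1]) (use t energy in auto)
qed

theorem theorem2p1:
  fixes \<omega> \<kappa> \<nu> \<beta> q a b :: real
    and B :: "real \<Rightarrow> real \<Rightarrow> complex"
    and \<rho> u \<phi> :: "real \<Rightarrow> real \<Rightarrow> real"
    and B0 :: "real \<Rightarrow> complex"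
    and \<rho>0 u0 :: "real \<Rightarrow> real"
  assumes "a < b"
    and "\<beta> \<noteq> \<nu>\<^sup>2"
    and "q = \<kappa> + \<nu> * (\<kappa> * \<nu> - 1) / (4 * (\<beta> - \<nu>\<^sup>2))"
    and "sufficiently_smooth B \<rho> u \<phi>"
    and "periodic_field a b B" and "periodic_field a b \<rho>"
    and "periodic_field a b u" and "periodic_field a b \<phi>"
    and "solves_system \<omega> \<kappa> \<nu> \<beta> q a b B \<rho> u \<phi>"
    and "\<forall>x\<in>{a..b}. B x 0 = B0 x \<and> \<rho> x 0 = \<rho>0 x \<and> u x 0 = u0 x \<and> \<phi> x 0 = (cmod (B0 x))\<^sup>2"
  shows "(\<forall>x\<in>{a..b}. \<forall>t\<ge>0. H1 B \<phi> x t = H1 B \<phi> x 0 \<and> H1 B \<phi> x 0 = 0) \<and>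
         (\<forall>t\<ge>0. energy \<omega> \<kappa> \<nu> \<beta> q a b B \<rho> u \<phi> t = energy \<omega> \<kappa> \<nu> \<beta> q a b B \<rho> u \<phi> 0)"
proof (intro conjI ballI allI impI)
  have C1: "C1_time B" "C1_time \<phi>"
    using assms(4) by (auto simp: sufficiently_smooth_def)
  fix x t :: real assume x: "x \<in> {a..b}" and "0 \<le> t"
  have "dt \<phi> x s = 2 * Re (cnj (B x s) * dt B x s)" if "0 \<le> s" for s
    using assms(9) x that by (auto simp: solves_system_def)
  then show "H1 B \<phi> x t = H1 B \<phi> x 0"
    using H1_conserved[OF C1] \<open>0 \<le> t\<close> by blast
  show "H1 B \<phi> x 0 = 0"
    using assms(10) x by (simp add: H1_def)
next
  fix t :: real assume "0 \<le> t"
  show "energy \<omega> \<kappa> \<nu> \<beta> q a b B \<rho> u \<phi> t = energy \<omega> \<kappa> \<nu> \<beta> q a b B \<rho> u \<phi> 0"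
    by (rule constant_on_nonneg[OF energy_has_derivative \<open>0 \<le> t\<close>]) (use assms in auto)
qed

end
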